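(* Assume that the linear operator $\mathcal A$ satisfies the $\delta$-$\mathrm{RIP}_{2r}$ property with $\delta<1/2$. For every $\epsilon>0$, with probability at least $\mathbb P(\|\mathbf A^Tw\| \leq \epsilon)$, the following holds: every local minimizer $\hat X \in \mathbb R^{n \times r}$ of the problem $\min_{X\in\mathbb R^{n\times r}} f(X)$, $f(X)=\frac12\|\mathcal A(XX^T)-b+w\|^2$, satisfies at least one of the two inequalities $$(1-\delta)\|\hat X\hat X^T-M^*\|_F^2 \leq \epsilon \sqrt{r}\, \|\hat X\hat X^T-M^*\|_F +4 \epsilon \sqrt{r}\, \|M^*\|_F,$$ $$\frac{2(1-2\delta)}{3(1+\delta)}\|\hat X\hat X^T-M^*\|_F \leq 2\epsilon\sqrt r +2\sqrt{2\epsilon(1+\delta)}\left(\|\hat X\hat X^T-M^*\|_F^{1/2}+\|M^*\|_F^{1/2}\right).$$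
   Context: Setting: $M^*\in\mathbb R^{n\times n}$ is a symmetric positive semidefinite matrix with $\mathrm{rank}(M^* )=r$ (the ground truth). $\mathcal A:\mathbb R^{n\times n}\to\mathbb R^m$ is the linear operator $\mathcal A(M)=[\langle A_1,M\rangle,\dots,\langle A_m,M\rangle]^T$ with given sensing matrices $A_1,\dots,A_m\in\mathbb R^{n\times n}$, where $\langle A,B\rangle=\mathrm{tr}(A^TB)$. $b=\mathcal A(M^* )$, and $w$ is a random noise vector in $\mathbb R^m$ with an arbitrary probability distribution. The matrix $\mathbf A=[\mathrm{vec}(A_1),\dots,\mathrm{vec}(A_m)]^T\in\mathbb R^{m\times n^2}$ represents $\mathcal A$, i.e. $\mathbf A\,\mathrm{vec}(M)=\mathcal A(M)$, where $\mathrm{vec}$ stacks the columns of a matrix. $\|\cdot\|$ is the Euclidean norm of a vector and $\|\cdot\|_F$ the Frobenius norm. RIP: for $\delta\in[0,1)$, $\mathcal A$ satisfies the $\delta$-$\mathrm{RIP}_{2r}$ property if $(1-\delta)\|M\|_F^2\le\|\mathcal A(M)\|^2\le(1+\delta)\|M\|_F^2$ for all $M\in\mathbb R^{n\times n}$ with $\mathrm{rank}(M)\le 2r$. *)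

theory Defs
  imports "HOL-Probability.Probability"
begin

text \<open>
  An n-by-k real matrix has type \<^typ>\<open>real^'k^'n\<close> (row index outermost). The \<^const>\<open>norm\<close> of
  such a matrix is its Frobenius norm, and the \<^const>\<open>norm\<close> of a \<^typ>\<open>real^'m\<close> is the
  Euclidean norm.
\<close>

definition frob_inner :: "real^'n^'n \<Rightarrow> real^'n^'n \<Rightarrow> real" where
  "frob_inner A B = trace (transpose A ** B)"

lemma frob_inner_eq_inner: "frob_inner A B = A \<bullet> B"
proof -
  have "frob_inner A B = (\<Sum>j\<in>UNIV. \<Sum>i\<in>UNIV. A $ i $ j * B $ i $ j)"
    by (simp add: frob_inner_def trace_def matrix_matrix_mult_def transpose_def)
  also have "\<dots> = (\<Sum>i\<in>UNIV. \<Sum>j\<in>UNIV. A $ i $ j * B $ i $ j)"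
    by (rule sum.swap)
  finally show ?thesis
    by (simp add: inner_vec_def)
qed

lemma norm_eq_sqrt_frob_inner: "norm A = sqrt (frob_inner A A)"
  by (simp add: frob_inner_eq_inner norm_eq_sqrt_inner)

definition sym_psd :: "real^'n^'n \<Rightarrow> bool" where
  "sym_psd M \<longleftrightarrow> transpose M = M \<and> (\<forall>x. 0 \<le> x \<bullet> (M *v x))"

definition sensing_op :: "('m \<Rightarrow> real^'n^'n) \<Rightarrow> real^'n^'n \<Rightarrow> real^'m" where
  "sensing_op A M = (\<chi> k. frob_inner (A k) M)"

text \<open>
  Column stacking: the coordinates of the vectorized matrix are indexed by pairs
  (column, row), so no numbering of the index type is needed.
\<close>

definition vectorize :: "real^'n^'n \<Rightarrow> real^('n \<times> 'n)" where
  "vectorize M = (\<chi> p. M $ snd p $ fst p)"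

definition sensing_matrix :: "('m \<Rightarrow> real^'n^'n) \<Rightarrow> real^('n \<times> 'n)^'m" where
  "sensing_matrix A = (\<chi> k. vectorize (A k))"

lemma sensing_matrix_vectorize: "sensing_matrix A *v vectorize M = sensing_op A M"
proof -
  have "(\<Sum>p\<in>UNIV. A k $ snd p $ fst p * M $ snd p $ fst p) = frob_inner (A k) M" for k
    by (simp add: frob_inner_def trace_def matrix_matrix_mult_def transpose_def
        sum.cartesian_product UNIV_Times_UNIV[symmetric] case_prod_unfold del: UNIV_Times_UNIV)
  then show ?thesis
    by (simp add: sensing_matrix_def sensing_op_def vectorize_def matrix_vector_mult_def)
qed

definition RIP :: "(real^'n^'n \<Rightarrow> real^'m) \<Rightarrow> real \<Rightarrow> nat \<Rightarrow> bool" where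
  "RIP L \<delta> k \<longleftrightarrow> 0 \<le> \<delta> \<and> \<delta> < 1 \<and>
     (\<forall>M. rank M \<le> k \<longrightarrow>
        (1 - \<delta>) * (norm M)\<^sup>2 \<le> (norm (L M))\<^sup>2 \<and> (norm (L M))\<^sup>2 \<le> (1 + \<delta>) * (norm M)\<^sup>2)"

definition objective ::
  "('m \<Rightarrow> real^'n^'n) \<Rightarrow> real^'m \<Rightarrow> real^'m \<Rightarrow> real^'r^'n \<Rightarrow> real" where
  "objective A b w X = 1/2 * (norm (sensing_op A (X ** transpose X) - b + w))\<^sup>2"

definition local_minimizer :: "('a::topological_space \<Rightarrow> real) \<Rightarrow> 'a \<Rightarrow> bool" where
  "local_minimizer f x \<longleftrightarrow> (\<forall>\<^sub>F y in nhds x. f x \<le> f y)"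

end

theory Submission
  imports Defs
begin

text \<open>
  Write \<open>L\<close> for the sensing operator, \<open>M\<close> for the ground truth and \<open>E = X X\<^sup>T - M\<close> for the error of
  a local minimiser \<open>X\<close>. On the event \<open>\<parallel>A\<^sup>T w\<parallel> \<le> \<epsilon>\<close>, where \<open>A\<close> is the sensing matrix, the inner
  product of the noise with any \<open>L N\<close> is at most \<open>\<epsilon> \<parallel>N\<parallel>\<close>
  (\<open>sensing_op_noise_bound\<close>), and for such noise
  \<open>(1 - 2 \<delta>) \<parallel>E\<parallel> \<le> 2 \<epsilon>\<close> (\<open>local_minimizer_error_bound\<close>). This implies the second alternative of the theorem,
  since \<open>2 / (3 (1 + \<delta>)) \<le> 1 \<le> \<surd>r\<close>.

  To see this bound, factor \<open>M = Z Z\<^sup>T\<close> with \<open>r\<close> columns, choosing among all such factors one with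
  \<open>X\<^sup>T Z\<close> symmetric (\<open>aligned_factor\<close>), and split \<open>Z = X K + Z2\<close> with \<open>X\<^sup>T Z2 = 0\<close>. Put
  \<open>W = Z2 Z2\<^sup>T\<close>, \<open>c = \<parallel>W\<parallel>\<close>, \<open>q = \<parallel>E + W\<parallel>\<^sup>2 = \<parallel>E\<parallel>\<^sup>2 - c\<^sup>2\<close>, let \<open>s\<close> be the least value of
  \<open>\<parallel>X v\<parallel>\<^sup>2\<close> over unit vectors, and \<open>\<tau> = s \<parallel>Z2\<parallel>\<^sup>2\<close>. The first-order condition makes the residual
  orthogonal to \<open>L (E + W)\<close>, the second-order condition bounds its inner product with \<open>L W\<close> from below
  by \<open>- (1 + \<delta>) \<tau>\<close>. Combining them at \<open>N = (E + W) - t W\<close> with the restricted isometry in its bilinear form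
  (\<open>RIP_inner\<close>) gives, for every \<open>t \<ge> 0\<close>,
  \<open>q + t c\<^sup>2 - (\<delta> \<parallel>E\<parallel> + \<epsilon>) \<surd>(q + t\<^sup>2 c\<^sup>2) \<le> t (1 + \<delta>) \<tau>\<close>.

  This contradicts \<open>\<delta> \<parallel>E\<parallel> + \<epsilon> < \<parallel>E\<parallel> / 2\<close> for a suitable \<open>t\<close> (\<open>scalar_contradiction\<close>), provided that
  \<open>\<tau>\<close> cannot be large when \<open>q\<close> is small. That is the content of \<open>residual_energy_bound\<close>:
  \<open>q + \<kappa>\<^sup>2 c\<^sup>2 \<ge> 2 \<kappa> \<tau>\<close> for \<open>0 \<le> \<kappa> \<le> 1\<close>, which says that a matrix \<open>M\<close> of rank at most \<open>r\<close> with
  mass outside the range of a well-conditioned \<open>X\<close> cannot also match \<open>X X\<^sup>T\<close> on that range.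

  The probability statement then reduces to inclusion of events, once the event that all local minimisers
  satisfy the alternative, which quantifies over uncountably many \<open>X\<close>, is known to be measurable (\<open>borel_exists_local_minimizer\<close>).
\<close>

section \<open>Matrix products and the Frobenius inner product\<close>

lemma bounded_bilinear_matrix_mult:
  "bounded_bilinear ((**) :: real^'a^'b \<Rightarrow> real^'c^'a \<Rightarrow> real^'c^'b)"
proof -
  have "bilinear ((**) :: real^'a^'b \<Rightarrow> real^'c^'a \<Rightarrow> real^'c^'b)"
    unfolding bilinear_def
    by (auto intro!: linearI simp: matrix_matrix_mult_def vec_eq_iff algebra_simps sum.distrib sum_distrib_left)
  then show ?thesis
    using bilinear_conv_bounded_bilinear by blast
qed

lemmas matmul_simps =
  bounded_bilinear.add_left[OF bounded_bilinear_matrix_mult]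
  bounded_bilinear.add_right[OF bounded_bilinear_matrix_mult]
  bounded_bilinear.diff_left[OF bounded_bilinear_matrix_mult]
  bounded_bilinear.diff_right[OF bounded_bilinear_matrix_mult]
  bounded_bilinear.scaleR_left[OF bounded_bilinear_matrix_mult]
  bounded_bilinear.scaleR_right[OF bounded_bilinear_matrix_mult]

lemma bounded_linear_transpose:
  "bounded_linear (transpose :: real^'a^'b \<Rightarrow> real^'b^'a)"
  by (auto intro!: linearI simp: transpose_def vec_eq_iff linear_conv_bounded_linear[symmetric])

lemmas transpose_simps =
  linear_0[OF bounded_linear.linear[OF bounded_linear_transpose]]
  linear_add[OF bounded_linear.linear[OF bounded_linear_transpose]]
  linear_diff[OF bounded_linear.linear[OF bounded_linear_transpose]]
  linear_scale[OF bounded_linear.linear[OF bounded_linear_transpose]]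

lemma inner_transpose_transpose: "transpose A \<bullet> transpose B = A \<bullet> (B :: real^'a^'b)"
  unfolding inner_vec_def transpose_def by (simp, rule sum.swap)

lemma inner_matrix_mult_left:
  fixes A :: "real^'a^'b"
  shows "(A ** B) \<bullet> C = B \<bullet> (transpose A ** C)"
proof -
  have "(A ** B) \<bullet> C = (\<Sum>i\<in>UNIV. \<Sum>j\<in>UNIV. \<Sum>k\<in>UNIV. A$i$k * B$k$j * C$i$j)"
    by (simp add: inner_vec_def matrix_matrix_mult_def sum_distrib_right)
  also have "\<dots> = (\<Sum>i\<in>UNIV. \<Sum>k\<in>UNIV. \<Sum>j\<in>UNIV. A$i$k * B$k$j * C$i$j)"
    by (intro sum.cong refl sum.swap)
  also have "\<dots> = (\<Sum>k\<in>UNIV. \<Sum>i\<in>UNIV. \<Sum>j\<in>UNIV. A$i$k * B$k$j * C$i$j)"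
    by (rule sum.swap)
  also have "\<dots> = (\<Sum>k\<in>UNIV. \<Sum>j\<in>UNIV. \<Sum>i\<in>UNIV. A$i$k * B$k$j * C$i$j)"
    by (intro sum.cong refl sum.swap)
  also have "\<dots> = B \<bullet> (transpose A ** C)"
    by (simp add: inner_vec_def matrix_matrix_mult_def transpose_def sum_distrib_left mult_ac)
  finally show ?thesis .
qed

lemma inner_matrix_mult_right:
  fixes A :: "real^'a^'b"
  shows "(A ** B) \<bullet> C = A \<bullet> (C ** transpose B)"
proof -
  have "(A ** B) \<bullet> C = (transpose B ** transpose A) \<bullet> transpose C"
    by (simp add: inner_transpose_transpose flip: matrix_transpose_mul)
  also have "\<dots> = transpose A \<bullet> transpose (C ** transpose B)"
    by (simp add: inner_matrix_mult_left matrix_transpose_mul)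
  finally show ?thesis
    by (simp add: inner_transpose_transpose)
qed

lemma norm_transpose: "norm (transpose A) = norm (A :: real^'a^'b)"
  by (simp add: norm_eq_sqrt_inner inner_transpose_transpose)

lemma rank_add_le: "rank (A + B) \<le> rank A + rank (B :: real^'a^'b)"
proof -
  let ?S = "{x + y |x y. x \<in> range ((*v) A) \<and> y \<in> range ((*v) B)}"
  have sub: "subspace (range ((*v) A))" "subspace (range ((*v) B))"
    by (auto intro!: linear_subspace_image)
  have "range ((*v) (A + B)) \<subseteq> ?S"
    by (auto simp: matrix_vector_mult_add_rdistrib)
  then have "dim (range ((*v) (A + B))) \<le> dim ?S"
    by (rule dim_subset)
  also have "\<dots> \<le> dim (range ((*v) A)) + dim (range ((*v) B))"
    using dim_sums_Int[OF sub] by linarith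
  finally show ?thesis
    by (simp add: rank_dim_range)
qed

text \<open>
  Every matrix to which the restricted isometry property is applied below has its columns in the
  span of the columns of two \<open>n\<close>-by-\<open>r\<close> matrices, which is what this bound is for.
\<close>

lemma rank_mult_sum_le:
  fixes X Z :: "real^'r^'n"
  shows "rank (X ** S + Z ** T) \<le> 2 * CARD('r)"
proof -
  have "rank (Y ** R) \<le> CARD('r)" for Y :: "real^'r^'n" and R :: "real^'k^'r"
    using rank_mul_le_left[of Y R] rank_bound[of Y] by simp
  then show ?thesis
    using rank_add_le[of "X ** S" "Z ** T"] by (smt (verit) mult_2 add_mono le_trans)
qed

definition outer :: "real^'a \<Rightarrow> real^'b \<Rightarrow> real^'b^'a" where
  "outer u v = (\<chi> i j. u $ i * v $ j)"

lemma transpose_outer: "transpose (outer u v) = outer v u"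
  by (simp add: outer_def transpose_def vec_eq_iff mult.commute)

lemma matrix_mult_outer: "A ** outer u v = outer (A *v u) v"
  by (simp add: outer_def matrix_matrix_mult_def matrix_vector_mult_def vec_eq_iff sum_distrib_left mult_ac)

lemma outer_mult_outer: "outer u v ** outer x y = (v \<bullet> x) *\<^sub>R outer u y"
  by (simp add: outer_def matrix_matrix_mult_def inner_vec_def vec_eq_iff sum_distrib_right sum_distrib_left mult_ac)

lemma outer_mult_vec: "outer u v *v x = (v \<bullet> x) *\<^sub>R u"
  by (simp add: outer_def matrix_vector_mult_def inner_vec_def vec_eq_iff sum_distrib_right sum_distrib_left mult_ac)

lemma inner_outer_outer: "outer u v \<bullet> outer x y = (u \<bullet> x) * (v \<bullet> y)"
  by (simp add: outer_def inner_vec_def sum_product mult_ac) (rule sum.swap)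

lemma gram_eq_sum_outer: "Z ** transpose Z = (\<Sum>k\<in>UNIV. outer (column k Z) (column k Z))"
  by (simp add: vec_eq_iff matrix_matrix_mult_def transpose_def outer_def column_def sum_component)

lemma transpose_mult_component: "(transpose X ** Z) $ i $ j = column i X \<bullet> column j (Z::real^'b^'c)"
  by (simp add: matrix_matrix_mult_def transpose_def column_def inner_vec_def)

lemma norm_square_eq_sum_columns: "(norm (Z :: real^'b^'c))\<^sup>2 = (\<Sum>k\<in>UNIV. (norm (column k Z))\<^sup>2)"
  unfolding power2_norm_eq_inner 
  by (simp add: inner_vec_def column_def) (rule sum.swap)

section \<open>Low-rank factors of positive semidefinite matrices\<close>

lemma sym_inner:
  assumes "transpose M = (M::real^'n^'n)"
  shows "x \<bullet> (M *v y) = (M *v x) \<bullet> y"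
  using assms by (metis dot_lmul_matrix transpose_matrix_vector)

lemma sym_psd_eq_0:
  assumes "sym_psd M" and "\<And>x. x \<bullet> (M *v x) = 0"
  shows "M = 0"
proof -
  have sym: "transpose M = M" using assms by (simp add: sym_psd_def)
  have "x \<bullet> (M *v y) = 0" for x y
    using assms(2)[of "x + y"] assms(2)[of x] assms(2)[of y] sym_inner[OF sym, of y x]
    by (simp add: matrix_vector_right_distrib inner_add inner_commute)
  then have "M *v y = 0" for y
    by (metis inner_eq_zero_iff)
  then show ?thesis
    by (metis matrix_eq matrix_vector_mult_0)
qed

text \<open>
  One step of an LDL decomposition along an arbitrary direction \<open>x\<close>. The quadratic form of the
  deflated matrix at \<open>z\<close> is that of \<open>M\<close> at the part of \<open>z\<close> that is \<open>M\<close>-orthogonal to \<open>x\<close>, hence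
  nonnegative. The range shrinks: \<open>x\<close> enters the kernel, so by symmetry the new range is
  orthogonal to \<open>x\<close>, while the old range contains \<open>M x\<close>, which is not.
\<close>

lemma sym_psd_deflate:
  assumes psd: "sym_psd M" and pos: "0 < x \<bullet> (M *v x)"
  defines "y \<equiv> (1 / sqrt (x \<bullet> (M *v x))) *\<^sub>R (M *v x)"
  shows "sym_psd (M - outer y y)" and "rank (M - outer y y) < rank M"
proof -
  let ?a = "x \<bullet> (M *v x)" and ?M = "M - outer y y"
  have sym: "transpose M = M" and nn: "\<And>z. 0 \<le> z \<bullet> (M *v z)"
    using psd by (auto simp: sym_psd_def)
  have symM: "transpose ?M = ?M"
    by (simp add: transpose_simps sym transpose_outer)
  have app: "?M *v z = M *v z - ((x \<bullet> (M *v z)) / ?a) *\<^sub>R (M *v x)" for z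
  proof -
    have "y \<bullet> z = (x \<bullet> (M *v z)) / sqrt ?a"
      by (simp add: y_def sym_inner[OF sym])
    then show ?thesis
      using pos by (simp add: matrix_vector_mult_diff_rdistrib outer_mult_vec)
        (simp add: y_def)
  qed
  have "0 \<le> z \<bullet> (?M *v z)" for z
  proof -
    let ?l = "(x \<bullet> (M *v z)) / ?a"
    have "z \<bullet> (M *v x) = x \<bullet> (M *v z)"
      by (metis sym_inner[OF sym] inner_commute)
    then have "(z - ?l *\<^sub>R x) \<bullet> (M *v (z - ?l *\<^sub>R x)) = z \<bullet> (?M *v z)"
      using pos by (simp add: app matrix_vector_mult_diff_distrib matrix_vector_mult_scaleR inner_diff)
    then show ?thesis
      using nn by metis
  qed
  then show "sym_psd ?M"
    using symM by (simp add: sym_psd_def)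
  have "range ((*v) ?M) \<subset> range ((*v) M)"
  proof
    show "range ((*v) ?M) \<subseteq> range ((*v) M)"
    proof safe
      fix z
      have "?M *v z = M *v (z - ((x \<bullet> (M *v z)) / ?a) *\<^sub>R x)"
        by (simp add: app matrix_vector_mult_diff_distrib matrix_vector_mult_scaleR)
      then show "?M *v z \<in> range ((*v) M)" by blast
    qed
    have "?M *v x = 0"
      using pos by (simp add: app)
    then have "x \<bullet> (?M *v z) = 0" for z
      by (metis sym_inner[OF symM] inner_zero_left)
    moreover have "x \<bullet> (M *v x) \<noteq> 0"
      using pos by simp
    ultimately have "M *v x \<notin> range ((*v) ?M)"
      by force
    then show "range ((*v) ?M) \<noteq> range ((*v) M)"
      by blast
  qed
  moreover have "subspace (range ((*v) ?M))" "subspace (range ((*v) M))"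
    by (auto intro!: linear_subspace_image)
  ultimately show "rank ?M < rank M"
    unfolding rank_dim_range by (intro dim_psubset) (simp add: span_eq_iff[THEN iffD2])
qed

text \<open>
  Deflating lowers the rank, so \<open>card I\<close> steps exhaust \<open>M\<close>. Counting the steps by the rank rather
  than by the size of \<open>M\<close> is what gives a factor with only \<open>r\<close> columns.
\<close>

lemma sym_psd_sum_outer:
  assumes "sym_psd M" "rank M \<le> card I" "finite I"
  shows "\<exists>z. M = (\<Sum>i\<in>I. outer (z i) (z i))"
  using assms(3,1,2)
proof (induction I arbitrary: M rule: finite_induct)
  case empty
  then show ?case by (simp add: rank_eq_0)
next
  case (insert i I)
  show ?case
  proof (cases "M = 0")
    case True
    then show ?thesis
      by (intro exI[of _ "\<lambda>_. 0"]) (simp add: outer_def vec_eq_iff)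
  next
    case False
    then obtain x where "x \<bullet> (M *v x) \<noteq> 0"
      using sym_psd_eq_0 insert.prems(1) by blast
    then have "0 < x \<bullet> (M *v x)"
      using insert.prems(1) by (auto simp: sym_psd_def less_le)
    from sym_psd_deflate[OF insert.prems(1) this] obtain y where
      y: "sym_psd (M - outer y y)" "rank (M - outer y y) < rank M"
      by blast
    then obtain z where "M - outer y y = (\<Sum>i\<in>I. outer (z i) (z i))"
      using insert by fastforce
    then have "M = outer y y + (\<Sum>k\<in>I. outer (z k) (z k))"
      by (simp add: algebra_simps)
    also have "\<dots> = (\<Sum>k\<in>insert i I. outer ((z(i := y)) k) ((z(i := y)) k))"
      using insert.hyps by (auto intro!: sum.cong)
    finally show ?thesis by blast
  qed
qed

lemma sym_psd_factor:
  fixes M :: "real^'n^'n"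
  assumes "sym_psd M" "rank M \<le> CARD('r::finite)"
  shows "\<exists>Z :: real^'r^'n. M = Z ** transpose Z"
proof -
  obtain z :: "'r \<Rightarrow> real^'n" where "M = (\<Sum>i\<in>UNIV. outer (z i) (z i))"
    using sym_psd_sum_outer[OF assms(1), of "UNIV :: 'r set"] assms(2) by auto
  then have "M = transpose (\<chi> k. z k) ** transpose (transpose (\<chi> k. z k))"
    unfolding gram_eq_sum_outer by (simp add: row_def)
  then show ?thesis by blast
qed

section \<open>Aligned factors and the energy of the residual\<close>

text \<open>
  Rotating the columns \<open>i\<close> and \<open>j\<close> of \<open>Z\<close> in their plane preserves \<open>Z Z\<^sup>T\<close> and makes \<open>\<langle>X, Z\<rangle>\<close>,
  up to a constant, \<open>c p + s d\<close>, where \<open>d\<close> is the asymmetry of the \<open>(i, j)\<close> entry of \<open>X\<^sup>T Z\<close>. At a maximiser the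
  value at \<open>(c, s) = (1, 0)\<close> dominates the whole circle, which forces \<open>d = 0\<close>. This replaces the
  usual appeal to the polar decomposition of \<open>X\<^sup>T Z\<close> in the orthogonal Procrustes problem.
\<close>

lemma symmetric_of_max_trace:
  fixes X Z :: "real^'r^'n"
  assumes max: "\<And>Z' :: real^'r^'n. Z' ** transpose Z' = Z ** transpose Z \<Longrightarrow> X \<bullet> Z' \<le> X \<bullet> Z"
  shows "transpose (transpose X ** Z) = transpose X ** Z"
proof -
  have inner_columns: "X \<bullet> Y = (\<Sum>k\<in>UNIV. column k X \<bullet> column k Y)" for Y :: "real^'r^'n"
    unfolding inner_vec_def column_def by (simp, rule sum.swap)
  have "column i X \<bullet> column j Z = column j X \<bullet> column i Z" for i j
  proof (cases "i = j")
    case False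
    define p where "p = column i X \<bullet> column i Z + column j X \<bullet> column j Z"
    define d where "d = column i X \<bullet> column j Z - column j X \<bullet> column i Z"
    have rot: "c * p + s * d \<le> p" if cs: "c\<^sup>2 + s\<^sup>2 = 1" for c s
    proof -
      define z where "z k = (if k = i then c *\<^sub>R column i Z + s *\<^sub>R column j Z
        else if k = j then c *\<^sub>R column j Z - s *\<^sub>R column i Z else column k Z)" for k
      define Z' where "Z' = transpose (\<chi> k. z k)"
      have col: "column k Z' = z k" for k
        by (simp add: Z'_def row_def)
      have split: "(\<Sum>k\<in>UNIV. f k) = f i + f j + (\<Sum>k\<in>UNIV - {i, j}. f k)"
        for f :: "'r \<Rightarrow> 'v::real_vector"
        using False by (simp add: sum.remove[of UNIV i] sum.remove[of "UNIV - {i}" j]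
            Diff_insert2[symmetric] insert_commute add.assoc)
      have zi: "z i = c *\<^sub>R column i Z + s *\<^sub>R column j Z"
        and zj: "z j = c *\<^sub>R column j Z - s *\<^sub>R column i Z"
        using False by (auto simp: z_def)
      have rest: "(\<Sum>k\<in>UNIV - {i, j}. f k (z k)) = (\<Sum>k\<in>UNIV - {i, j}. f k (column k Z))"
        for f :: "'r \<Rightarrow> real^'n \<Rightarrow> 'v::real_vector"
        by (intro sum.cong) (auto simp: z_def)
      have "outer (z i) (z i) + outer (z j) (z j)
          = (c\<^sup>2 + s\<^sup>2) *\<^sub>R outer (column i Z) (column i Z) + (c\<^sup>2 + s\<^sup>2) *\<^sub>R outer (column j Z) (column j Z)"
        unfolding zi zj outer_def by (simp add: vec_eq_iff algebra_simps power2_eq_square)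
      then have "Z' ** transpose Z' = Z ** transpose Z"
        unfolding gram_eq_sum_outer col split using rest[of "\<lambda>k v. outer v v"] cs by simp
      then have "X \<bullet> Z' \<le> X \<bullet> Z" by (rule max)
      then have "column i X \<bullet> z i + column j X \<bullet> z j \<le> p"
        unfolding inner_columns col split p_def using rest[of "\<lambda>k v. column k X \<bullet> v"] by simp
      then show ?thesis
        by (simp add: zi zj p_def d_def inner_add inner_diff algebra_simps)
    qed
    have "d = 0"
    proof (rule ccontr)
      assume "d \<noteq> 0"
      \<comment> \<open>the maximum of \<open>c p + s d\<close> over the unit circle is \<open>n\<close>, attained at \<open>(p, d) / n\<close>\<close>
      define n where "n = sqrt (p\<^sup>2 + d\<^sup>2)"
      have n: "n\<^sup>2 = p\<^sup>2 + d\<^sup>2" "0 < n"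
        using \<open>d \<noteq> 0\<close> by (auto simp: n_def sum_power2_gt_zero_iff)
      have "(p / n)\<^sup>2 + (d / n)\<^sup>2 = 1"
        using n(2) by (simp add: power_divide n(1)[symmetric] flip: add_divide_distrib)
      from rot[OF this] have "n * n \<le> n * p"
        using n by (simp add: field_simps power2_eq_square)
      then have "n \<le> p"
        using n(2) by simp
      then have "n\<^sup>2 \<le> p\<^sup>2"
        using n by (intro power_mono) auto
      then show False
        using n \<open>d \<noteq> 0\<close> by simp
    qed
    then show ?thesis by (simp add: d_def)
  qed simp
  then show ?thesis
    by (simp add: vec_eq_iff transpose_mult_component transpose_def[of "transpose X ** Z"])
qed

lemma continuous_gram: "continuous_on S (\<lambda>Z :: real^'r^'n. Z ** transpose Z)"
  by (intro bounded_bilinear.continuous_on[OF bounded_bilinear_matrix_mult]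
      linear_continuous_on[OF bounded_linear_transpose] continuous_on_id)

lemma norm_square_eq_trace_gram:
  "(norm (Z :: real^'r^'n))\<^sup>2 = mat 1 \<bullet> (Z ** transpose Z)"
  by (metis inner_commute inner_matrix_mult_right matrix_mul_lid power2_norm_eq_inner transpose_transpose)

lemma compact_gram_fibre: "compact {Z :: real^'r^'n. Z ** transpose Z = M}"
proof -
  have "norm Z \<le> sqrt (mat 1 \<bullet> M)" if "Z ** transpose Z = M" for Z :: "real^'r^'n"
    using norm_square_eq_trace_gram[of Z] that by (metis norm_ge_zero order_refl real_sqrt_unique)
  then have "bounded {Z :: real^'r^'n. Z ** transpose Z = M}"
    by (auto simp: bounded_iff)
  moreover have "closed {Z :: real^'r^'n. Z ** transpose Z = M}"
    by (intro closed_Collect_eq continuous_gram continuous_on_const)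
  ultimately show ?thesis
    by (simp add: compact_eq_bounded_closed)
qed

lemma aligned_factor:
  fixes X Z0 :: "real^'r^'n"
  obtains Z :: "real^'r^'n" where "Z ** transpose Z = Z0 ** transpose Z0"
    and "transpose (transpose X ** Z) = transpose X ** Z"
proof -
  let ?S = "{Z :: real^'r^'n. Z ** transpose Z = Z0 ** transpose Z0}"
  have "continuous_on ?S (\<lambda>Z. X \<bullet> Z)"
    by (intro continuous_intros)
  then obtain Z where "Z \<in> ?S" "\<And>Y. Y \<in> ?S \<Longrightarrow> X \<bullet> Y \<le> X \<bullet> Z"
    using continuous_attains_sup[OF compact_gram_fibre, of "Z0 ** transpose Z0" "\<lambda>Z. X \<bullet> Z"] by blast
  then show thesis
    using symmetric_of_max_trace[of Z X] that by auto
qed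

lemma column_projection:
  fixes X :: "real^'r^'n" and Z :: "real^'k^'n"
  obtains K Z2 where "Z = X ** K + Z2" and "transpose X ** Z2 = 0"
proof -
  have "\<exists>k. \<forall>x. (X *v x) \<bullet> (z - X *v k) = 0" for z
  proof -
    obtain y u where yu: "y \<in> span (range ((*v) X))" "\<And>w. w \<in> span (range ((*v) X)) \<Longrightarrow> orthogonal u w" "z = y + u"
      using orthogonal_subspace_decomp_exists[of "range ((*v) X)" z] by blast
    moreover have "span (range ((*v) X)) = range ((*v) X)"
      by (intro span_eq_iff[THEN iffD2] linear_subspace_image) auto
    ultimately obtain k where "y = X *v k"
      by auto
    with yu have "(X *v x) \<bullet> (z - X *v k) = 0" for x
      using yu(2)[OF span_base[of "X *v x"]] by (simp add: orthogonal_def inner_commute)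
    then show ?thesis by blast
  qed
  then obtain k where k: "\<And>z x. (X *v x) \<bullet> (z - X *v k z) = 0"
    by metis
  define K :: "real^'k^'r" where "K = (\<chi> i j. k (column j Z) $ i)"
  have col: "column j (X ** K) = X *v k (column j Z)" for j
    by (simp add: K_def column_def matrix_matrix_mult_def matrix_vector_mult_def vec_eq_iff)
  have "column i X \<bullet> column j (Z - X ** K) = 0" for i j
  proof -
    have "column j (Z - X ** K) = column j Z - column j (X ** K)"
      by (simp add: column_def vec_eq_iff)
    then show ?thesis
      using k[of "axis i 1" "column j Z"] by (simp add: col matrix_vector_mult_basis)
  qed
  then have "transpose X ** (Z - X ** K) = 0"
    by (simp add: vec_eq_iff transpose_mult_component)
  then show thesis
    using that[of K "Z - X ** K"] by simp
qed

lemma smallest_singular_vector: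
  fixes X :: "real^'r^'n"
  obtains v where "norm v = 1" and "\<And>x. (norm (X *v v))\<^sup>2 * (norm x)\<^sup>2 \<le> (norm (X *v x))\<^sup>2"
proof -
  have "axis undefined 1 \<in> sphere (0 :: real^'r) 1"
    by simp
  then have "sphere (0 :: real^'r) 1 \<noteq> {}" by blast
  moreover have "continuous_on (sphere 0 1) (\<lambda>x. norm (X *v x))"
    by (intro continuous_intros)
  ultimately obtain v where v: "norm v = 1" "\<And>x. norm x = 1 \<Longrightarrow> norm (X *v v) \<le> norm (X *v x)"
    using continuous_attains_inf[OF compact_sphere, of "0::real^'r" 1 "\<lambda>x. norm (X *v x)"] by auto
  have "norm (X *v v) * norm x \<le> norm (X *v x)" for x
  proof (cases "x = 0")
    case False
    then have "norm (X *v v) \<le> norm (X *v ((1 / norm x) *\<^sub>R x))"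
      by (intro v) simp
    then show ?thesis
      using False by (simp add: matrix_vector_mult_scaleR field_simps)
  qed simp
  then have "(norm (X *v v) * norm x)\<^sup>2 \<le> (norm (X *v x))\<^sup>2" for x
    by (intro power_mono) auto
  then show thesis
    using that v by (simp add: power_mult_distrib)
qed

text \<open>
  The geometric heart of the matter, where it is used that both factors have the same number of
  columns. Every Frobenius norm in the statement becomes an inner product of the \<open>r\<close>-by-\<open>r\<close> Gram matrices
  \<open>G = X\<^sup>T X\<close>, \<open>C = (X K)\<^sup>T (X K)\<close>, \<open>B = Z2\<^sup>T Z2\<close> and of \<open>Y = X\<^sup>T Z = G K\<close>. If \<open>\<parallel>Y\<parallel>\<^sup>2\<close> were
  equal to \<open>\<langle>G, C\<rangle>\<close> and \<open>s \<parallel>Z2\<parallel>\<^sup>2\<close> to \<open>\<langle>G, B\<rangle>\<close>, the difference of the two sides would be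
  \<open>\<parallel>G - C - \<kappa> B\<parallel>\<^sup>2 + 2 (1 - \<kappa>) \<langle>C, B\<rangle>\<close>. Symmetry of \<open>Y\<close> gives \<open>\<parallel>Y\<parallel>\<^sup>2 \<le> \<langle>G, C\<rangle>\<close>, because
  \<open>T = X K X\<^sup>T\<close> then satisfies \<open>\<langle>T, T\<^sup>T\<rangle> = \<parallel>Y\<parallel>\<^sup>2\<close> and \<open>\<langle>T, T\<rangle> = \<langle>G, C\<rangle>\<close>; the bound on the
  singular values of \<open>X\<close> gives \<open>s \<parallel>Z2\<parallel>\<^sup>2 \<le> \<langle>G, B\<rangle>\<close>.
\<close>

lemma residual_energy_bound:
  fixes X Z2 :: "real^'r^'n"
  assumes Z: "Z = X ** K + Z2" and orth: "transpose X ** Z2 = 0"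
    and sym: "transpose (transpose X ** Z) = transpose X ** Z"
    and s: "\<And>x. s * (norm x)\<^sup>2 \<le> (norm (X *v x))\<^sup>2"
    and \<kappa>: "0 \<le> \<kappa>" "\<kappa> \<le> 1"
  shows "2 * \<kappa> * (s * (norm Z2)\<^sup>2) - \<kappa>\<^sup>2 * (norm (Z2 ** transpose Z2))\<^sup>2
    \<le> (norm (X ** transpose X - Z ** transpose Z))\<^sup>2 - (norm (Z2 ** transpose Z2))\<^sup>2"
proof -
  define G where "G = transpose X ** X"
  define Y where "Y = transpose X ** Z"
  define C where "C = transpose K ** G ** K"
  define B where "B = transpose Z2 ** Z2"
  have orth': "transpose Z2 ** X = 0"
    using arg_cong[OF orth, of transpose]
    by (simp add: matrix_transpose_mul transpose_simps)
  have symG: "transpose G = G"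
    by (simp add: G_def matrix_transpose_mul)
  have Y: "Y = G ** K"
    by (simp add: Y_def Z matmul_simps orth G_def matrix_mul_assoc)
  have YT: "Y = transpose K ** G"
    using sym Y symG by (metis Y_def matrix_transpose_mul)
  have gram: "transpose Z ** Z = C + B"
  proof -
    have "transpose Z ** Z = transpose K ** (transpose X ** X) ** K + transpose K ** (transpose X ** Z2)
       + (transpose Z2 ** X) ** K + B"
      by (simp add: Z matmul_simps transpose_simps matrix_transpose_mul B_def matrix_mul_assoc)
    then show ?thesis
      by (simp add: orth orth' C_def G_def)
  qed
  have gram_inner: "(U ** transpose U) \<bullet> (V ** transpose V) = (transpose V ** U) \<bullet> (transpose V ** U)"
    for U :: "real^'p^'q" and V :: "real^'k^'q"
    by (simp add: inner_matrix_mult_right[of U] inner_matrix_mult_left[of "transpose V"]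
        flip: matrix_mul_assoc)
  have gram_swap: "(transpose U ** U) \<bullet> (transpose V ** V) = (norm (V ** transpose U))\<^sup>2"
    for U :: "real^'p^'q" and V :: "real^'p^'k"
    using gram_inner[of "transpose U" "transpose V"] by (simp add: power2_norm_eq_inner)
  have e2: "(norm (X ** transpose X - Z ** transpose Z))\<^sup>2 = G \<bullet> G - 2 * (Y \<bullet> Y) + (C + B) \<bullet> (C + B)"
    using gram_inner[of X Z] gram_inner[of X X] gram_inner[of Z Z] gram_inner[of Z X]
    by (simp add: power2_norm_eq_inner inner_diff inner_commute G_def Y_def flip: gram)
  have c2: "(norm (Z2 ** transpose Z2))\<^sup>2 = B \<bullet> B"
    using gram_inner[of Z2 Z2] by (simp add: power2_norm_eq_inner B_def)
  have YG: "Y \<bullet> Y \<le> G \<bullet> C"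
  proof -
    define T where "T = X ** K ** transpose X"
    have "T \<bullet> transpose T \<le> T \<bullet> T"
      using inner_ge_zero[of "T - transpose T"]
      by (simp add: inner_diff inner_transpose_transpose inner_commute)
    moreover have "T \<bullet> T = G \<bullet> C"
    proof -
      have "G \<bullet> C = (K ** G) \<bullet> (G ** K)"
        by (simp add: C_def inner_matrix_mult_left flip: matrix_mul_assoc)
      also have "\<dots> = K \<bullet> (G ** K ** G)"
        by (simp add: inner_matrix_mult_right symG)
      also have "\<dots> = T \<bullet> T"
        by (simp add: T_def G_def inner_matrix_mult_right[of "X ** K"] inner_matrix_mult_left[of X K] matrix_mul_assoc)
      finally show ?thesis by simp
    qed
    moreover have "T \<bullet> transpose T = Y \<bullet> Y"
    proof -
      have "T \<bullet> transpose T = K \<bullet> (G ** (transpose K ** G))"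
        by (simp add: T_def G_def inner_matrix_mult_right[of "X ** K"] inner_matrix_mult_left[of X K]
            matrix_transpose_mul matrix_mul_assoc)
      also have "\<dots> = (G ** K) \<bullet> Y"
        by (simp add: inner_matrix_mult_left symG flip: YT)
      finally show ?thesis
        by (simp flip: Y)
    qed
    ultimately show ?thesis by simp
  qed
  have CB: "0 \<le> C \<bullet> B"
    using gram_swap[of "X ** K" Z2]
    by (simp add: C_def B_def G_def matrix_transpose_mul matrix_mul_assoc)
  have GB: "s * (norm Z2)\<^sup>2 \<le> G \<bullet> B"
  proof -
    have "s * (norm Z2)\<^sup>2 = (\<Sum>k\<in>UNIV. s * (norm (column k (transpose Z2)))\<^sup>2)"
      by (metis norm_square_eq_sum_columns norm_transpose sum_distrib_left)
    also have "\<dots> \<le> (\<Sum>k\<in>UNIV. (norm (X *v column k (transpose Z2)))\<^sup>2)"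
      by (intro sum_mono s)
    also have "\<dots> = (norm (X ** transpose Z2))\<^sup>2"
      unfolding norm_square_eq_sum_columns[of "X ** transpose Z2"]
      by (simp add: column_def matrix_matrix_mult_def matrix_vector_mult_def)
    also have "\<dots> = G \<bullet> B"
      using gram_swap[of Z2 X] by (simp add: G_def B_def inner_commute)
    finally show ?thesis .
  qed
  have "0 \<le> (G - C - \<kappa> *\<^sub>R B) \<bullet> (G - C - \<kappa> *\<^sub>R B) + 2 * (G \<bullet> C - Y \<bullet> Y)
      + 2 * ((1 - \<kappa>) * (C \<bullet> B)) + 2 * (\<kappa> * (G \<bullet> B - s * (norm Z2)\<^sup>2))"
    using YG CB GB \<kappa> by (intro add_nonneg_nonneg mult_nonneg_nonneg) auto
  then show ?thesis
    unfolding e2 c2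
    by (simp add: inner_diff inner_add inner_commute algebra_simps power2_eq_square)
qed

section \<open>Optimality conditions for the factored least-squares problem\<close>

lemma local_min_quartic:
  fixes a b c d :: real
  assumes "local_minimizer (\<lambda>t. k + a * t + b * t\<^sup>2 + c * t ^ 3 + d * t ^ 4) 0"
  shows "a = 0" and "0 \<le> b"
proof -
  have nonneg: "\<forall>\<^sub>F t in nhds 0. 0 \<le> a * t + b * t\<^sup>2 + c * t ^ 3 + d * t ^ 4"
    using assms unfolding local_minimizer_def by (rule eventually_mono) simp
  have lim: "((\<lambda>t. a + b * t + c * t\<^sup>2 + d * t ^ 3) \<longlongrightarrow> a) (at 0 within S)" for S
    by (rule tendsto_eq_intros refl | simp)+
  have "\<forall>\<^sub>F t in at_right 0. 0 \<le> a + b * t + c * t\<^sup>2 + d * t ^ 3"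
  proof -
    have "\<forall>\<^sub>F t in at_right 0. 0 \<le> a * t + b * t\<^sup>2 + c * t ^ 3 + d * t ^ 4"
      using nonneg by (auto simp: eventually_at_filter elim: eventually_mono)
    then show ?thesis
      using eventually_at_right_less[of 0]
    proof eventually_elim
      case (elim t)
      then have "0 \<le> t * (a + b * t + c * t\<^sup>2 + d * t ^ 3)"
        by (simp add: algebra_simps power2_eq_square power3_eq_cube power4_eq_xxxx)
      then show ?case
        using elim by (simp add: zero_le_mult_iff)
    qed
  qed
  then have "0 \<le> a"
    by (intro tendsto_lowerbound[OF lim]) auto
  have "\<forall>\<^sub>F t in at_left 0. a + b * t + c * t\<^sup>2 + d * t ^ 3 \<le> 0"
  proof -
    have "\<forall>\<^sub>F t in at_left 0. 0 \<le> a * t + b * t\<^sup>2 + c * t ^ 3 + d * t ^ 4"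
      using nonneg by (auto simp: eventually_at_filter elim: eventually_mono)
    moreover have "\<forall>\<^sub>F t in at_left 0. t < (0::real)"
      by (simp add: eventually_at_filter)
    ultimately show ?thesis
    proof eventually_elim
      case (elim t)
      then have "0 \<le> t * (a + b * t + c * t\<^sup>2 + d * t ^ 3)"
        by (simp add: algebra_simps power2_eq_square power3_eq_cube power4_eq_xxxx)
      then show ?case
        using elim by (simp add: zero_le_mult_iff)
    qed
  qed
  then have "a \<le> 0"
    by (intro tendsto_upperbound[OF lim]) auto
  with \<open>0 \<le> a\<close> show "a = 0" by simp
  have lim': "((\<lambda>t. b + c * t + d * t\<^sup>2) \<longlongrightarrow> b) (at 0)"
    by (rule tendsto_eq_intros refl | simp)+
  have "\<forall>\<^sub>F t in at 0. 0 \<le> a * t + b * t\<^sup>2 + c * t ^ 3 + d * t ^ 4"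
    using nonneg by (auto simp: eventually_at_filter elim: eventually_mono)
  moreover have "\<forall>\<^sub>F t in at 0. t \<noteq> (0::real)"
    by (simp add: eventually_at_filter)
  ultimately have "\<forall>\<^sub>F t in at 0. 0 \<le> b + c * t + d * t\<^sup>2"
  proof eventually_elim
    case (elim t)
    then have "0 \<le> t\<^sup>2 * (b + c * t + d * t\<^sup>2)"
      by (simp add: \<open>a = 0\<close> algebra_simps power2_eq_square power3_eq_cube power4_eq_xxxx)
    then show ?case
      using elim by (simp add: zero_le_mult_iff)
  qed
  then show "0 \<le> b"
    by (intro tendsto_lowerbound[OF lim']) auto
qed

lemma local_minimizer_line:
  fixes X U :: "'a::real_normed_vector"
  assumes "local_minimizer f X"
  shows "local_minimizer (\<lambda>t::real. f (X + t *\<^sub>R U)) 0"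
proof -
  have "((\<lambda>t. X + t *\<^sub>R U) \<longlongrightarrow> X + 0 *\<^sub>R U) (nhds 0)"
    by (intro tendsto_intros filterlim_ident)
  then have "filterlim (\<lambda>t. X + t *\<^sub>R U) (nhds X) (nhds 0)"
    by simp
  from eventually_compose_filterlim[OF assms[unfolded local_minimizer_def] this] show ?thesis
    by (simp add: local_minimizer_def)
qed

text \<open>
  Along the line \<open>X + t U\<close> the objective is a quartic polynomial in \<open>t\<close>; its linear and quadratic
  coefficients at a local minimiser give these two conditions.
\<close>

lemma factored_least_squares_conditions:
  fixes L :: "real^'n^'n \<Rightarrow> 'b::real_inner" and X U :: "real^'r^'n"
  assumes lin: "linear L"
    and min: "local_minimizer (\<lambda>X. 1/2 * (norm (L (X ** transpose X) - b + w))\<^sup>2) X"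
  defines "R \<equiv> L (X ** transpose X) - b + w"
    and "D \<equiv> X ** transpose U + U ** transpose X"
  shows "R \<bullet> L D = 0" and "0 \<le> R \<bullet> L (U ** transpose U) + 1/2 * (norm (L D))\<^sup>2"
proof -
  let ?N = "L (U ** transpose U)"
  have expansion: "1/2 * (norm (L ((X + t *\<^sub>R U) ** transpose (X + t *\<^sub>R U)) - b + w))\<^sup>2
      = 1/2 * (R \<bullet> R) + (R \<bullet> L D) * t + (R \<bullet> ?N + 1/2 * (norm (L D))\<^sup>2) * t\<^sup>2
        + (L D \<bullet> ?N) * t ^ 3 + (1/2 * (?N \<bullet> ?N)) * t ^ 4" for t :: real
  proof -
    have "(X + t *\<^sub>R U) ** transpose (X + t *\<^sub>R U) = X ** transpose X + t *\<^sub>R D + t\<^sup>2 *\<^sub>R (U ** transpose U)"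
      by (simp add: D_def matmul_simps transpose_simps algebra_simps power2_eq_square)
    then have "L ((X + t *\<^sub>R U) ** transpose (X + t *\<^sub>R U)) - b + w = R + t *\<^sub>R L D + t\<^sup>2 *\<^sub>R ?N"
      by (simp add: R_def linear_add[OF lin] linear_scale[OF lin])
    then show ?thesis
      by (simp only: power2_norm_eq_inner)
        (simp add: inner_add inner_commute algebra_simps power2_eq_square power3_eq_cube power4_eq_xxxx)
  qed
  have *: "local_minimizer (\<lambda>t. 1/2 * (R \<bullet> R) + (R \<bullet> L D) * t
      + (R \<bullet> ?N + 1/2 * (norm (L D))\<^sup>2) * t\<^sup>2 + (L D \<bullet> ?N) * t ^ 3 + (1/2 * (?N \<bullet> ?N)) * t ^ 4) 0"
    using local_minimizer_line[OF min, of U] unfolding expansion .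
  show "R \<bullet> L D = 0" "0 \<le> R \<bullet> ?N + 1/2 * (norm (L D))\<^sup>2"
    using local_min_quartic[OF *] by auto
qed

section \<open>Error bound for local minimisers\<close>

text \<open>
  Polarisation applied to \<open>E / \<parallel>E\<parallel> \<plusminus> N / \<parallel>N\<parallel>\<close>, multiplied through by \<open>\<parallel>E\<parallel> \<parallel>N\<parallel>\<close>; the unit
  normalisation is what makes the loss \<open>\<delta> \<parallel>E\<parallel> \<parallel>N\<parallel>\<close>.
\<close>

lemma RIP_inner:
  assumes rip: "RIP L \<delta> k" and lin: "linear L"
    and rank: "\<And>a b. rank (a *\<^sub>R E + b *\<^sub>R N) \<le> k"
  shows "E \<bullet> N - \<delta> * norm E * norm N \<le> L E \<bullet> L N"
proof (cases "E = 0 \<or> N = 0")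
  case True
  then show ?thesis
    using linear_0[OF lin] by auto
next
  case False
  let ?a = "norm N" and ?b = "norm E"
  let ?P = "?a *\<^sub>R E + ?b *\<^sub>R N" and ?M = "?a *\<^sub>R E + (- ?b) *\<^sub>R N"
  have bounds: "(1 - \<delta>) * (norm ?P)\<^sup>2 \<le> (norm (L ?P))\<^sup>2" "(norm (L ?M))\<^sup>2 \<le> (1 + \<delta>) * (norm ?M)\<^sup>2"
    using rip rank unfolding RIP_def by blast+
  have P: "(norm ?P)\<^sup>2 = 2 * (?a * ?b)\<^sup>2 + 2 * (?a * ?b) * (E \<bullet> N)"
    unfolding power2_norm_eq_inner
    by (simp add: inner_add inner_commute power_mult_distrib power2_norm_eq_inner)
      (simp add: power2_eq_square algebra_simps flip: power2_norm_eq_inner)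
  have M: "(norm ?M)\<^sup>2 = 2 * (?a * ?b)\<^sup>2 - 2 * (?a * ?b) * (E \<bullet> N)"
    unfolding power2_norm_eq_inner
    by (simp add: inner_diff inner_commute power_mult_distrib power2_norm_eq_inner)
      (simp add: power2_eq_square algebra_simps flip: power2_norm_eq_inner)
  have "(4 * (?a * ?b)) * (E \<bullet> N - \<delta> * (?a * ?b)) = (1 - \<delta>) * (norm ?P)\<^sup>2 - (1 + \<delta>) * (norm ?M)\<^sup>2"
    unfolding P M by (simp add: algebra_simps power2_eq_square)
  also have "\<dots> \<le> (norm (L ?P))\<^sup>2 - (norm (L ?M))\<^sup>2"
    using bounds by linarith
  also have "\<dots> = (4 * (?a * ?b)) * (L E \<bullet> L N)"
    unfolding power2_norm_eq_inner
    by (simp add: linear_add[OF lin] linear_diff[OF lin] linear_scale[OF lin] inner_add inner_diff inner_commute algebra_simps)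
  finally have "(4 * (?a * ?b)) * (E \<bullet> N - \<delta> * (?a * ?b)) \<le> (4 * (?a * ?b)) * (L E \<bullet> L N)" .
  moreover have "0 < 4 * (?a * ?b)"
    using False by simp
  ultimately show ?thesis
    by (simp only: mult_le_cancel_left_pos) (simp add: mult_ac)
qed

lemma sensing_op_noise_bound:
  "\<bar>w \<bullet> sensing_op A M\<bar> \<le> norm (transpose (sensing_matrix A) *v w) * norm M"
proof -
  have "vectorize M \<bullet> vectorize M = (\<Sum>j\<in>UNIV. \<Sum>i\<in>UNIV. M $ i $ j * M $ i $ j)"
    by (simp add: vectorize_def inner_vec_def sum.cartesian_product UNIV_Times_UNIV[symmetric] case_prod_unfold
        del: UNIV_Times_UNIV)
  also have "\<dots> = M \<bullet> M"
    unfolding inner_vec_def by (simp, rule sum.swap)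
  finally have "norm (vectorize M) = norm M"
    by (simp add: norm_eq_sqrt_inner)
  moreover have "w \<bullet> sensing_op A M = (transpose (sensing_matrix A) *v w) \<bullet> vectorize M"
    by (simp add: dot_lmul_matrix sensing_matrix_vectorize)
  ultimately show ?thesis
    by (metis Cauchy_Schwarz_ineq2)
qed

lemma linear_sensing_op: "linear (sensing_op A)"
  unfolding sensing_op_def frob_inner_eq_inner
  by (intro linearI) (auto simp: vec_eq_iff inner_add)

text \<open>
  The place where the threshold \<open>1/2\<close> comes from. The assumption \<open>opt\<close> bounds the inner product
  of \<open>(\<surd>q, t c)\<close> and \<open>(\<surd>q, c - 3\<tau> / (2 c))\<close> by \<open>D\<close> times the norm of the first vector. It is
  strongest for the \<open>t\<close> that makes them parallel, or for \<open>t = 0\<close> if the second coordinate is not positive.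
  In the parallel case, with \<open>\<kappa> = \<tau> / c\<^sup>2\<close>, what remains is \<open>3 (2 \<kappa> - 1)\<^sup>2 c\<^sup>2 < 0\<close>; the square vanishes at \<open>\<kappa> = 1/2\<close>,
  so there is no slack in the bound \<open>D < e / 2\<close>.
\<close>

lemma scalar_contradiction:
  fixes e c q \<tau> D :: real
  assumes e: "0 < e" "e\<^sup>2 = q + c\<^sup>2" "0 \<le> c" "0 \<le> q" "0 \<le> \<tau>" and D: "0 \<le> D" "D < e / 2"
    and key: "\<And>\<kappa>. 0 \<le> \<kappa> \<Longrightarrow> \<kappa> \<le> 1 \<Longrightarrow> 2 * \<kappa> * \<tau> - \<kappa>\<^sup>2 * c\<^sup>2 \<le> q"
    and opt: "\<And>t. 0 \<le> t \<Longrightarrow> q + t * c\<^sup>2 - D * sqrt (q + t\<^sup>2 * c\<^sup>2) \<le> t * (3/2 * \<tau>)"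
  shows False
proof -
  have D2: "4 * D\<^sup>2 < q + c\<^sup>2"
  proof -
    have "(2 * D)\<^sup>2 < e\<^sup>2"
      using D by (intro power_strict_mono) auto
    then show ?thesis
      using e by (simp add: power_mult_distrib)
  qed
  have square: "x \<le> D\<^sup>2" if "x \<le> D * sqrt x" "0 \<le> x" for x
  proof (cases "x = 0")
    case False
    then have "sqrt x * sqrt x \<le> D * sqrt x" "0 < sqrt x"
      using that by auto
    then have "sqrt x \<le> D"
      by (rule mult_right_le_imp_le)
    then have "(sqrt x)\<^sup>2 \<le> D\<^sup>2"
      using that by (intro power_mono) auto
    then show ?thesis
      using that by simp
  qed simp
  show False
  proof (cases "c\<^sup>2 \<le> 3/2 * \<tau>")
    case True
    have "q \<le> D\<^sup>2"
      using opt[of 0] e by (intro square) auto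
    then show False
      using D2 key[of 1] True by simp
  next
    case False
    then have c: "0 < c\<^sup>2"
      using e by linarith
    define \<kappa> where "\<kappa> = \<tau> / c\<^sup>2"
    have \<tau>: "\<tau> = \<kappa> * c\<^sup>2"
      using c by (simp add: \<kappa>_def)
    have \<kappa>: "0 \<le> \<kappa>" "\<kappa> < 2/3"
      using False c e by (auto simp: \<kappa>_def field_simps)
    define t where "t = 1 - 3/2 * \<kappa>"
    have "q + t\<^sup>2 * c\<^sup>2 \<le> D\<^sup>2"
    proof (rule square)
      have "q + t * c\<^sup>2 - t * (3/2 * \<tau>) = q + t\<^sup>2 * c\<^sup>2"
        by (simp add: \<tau> t_def field_simps power2_eq_square)
      then show "q + t\<^sup>2 * c\<^sup>2 \<le> D * sqrt (q + t\<^sup>2 * c\<^sup>2)"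
        using opt[of t] \<kappa> by (simp add: t_def)
      show "0 \<le> q + t\<^sup>2 * c\<^sup>2"
        using e by simp
    qed
    moreover have "\<kappa>\<^sup>2 * c\<^sup>2 \<le> q"
      using key[of \<kappa>] \<kappa> by (simp add: \<tau> power2_eq_square)
    ultimately have "(3 * \<kappa>\<^sup>2 + 4 * t\<^sup>2 - 1) * c\<^sup>2 < 0"
      using D2 by (simp add: algebra_simps)
    moreover have "3 * \<kappa>\<^sup>2 + 4 * t\<^sup>2 - 1 = 3 * (2 * \<kappa> - 1)\<^sup>2"
      by (simp add: t_def algebra_simps power2_eq_square)
    ultimately show False
      using c by (simp add: mult_less_0_iff)
  qed
qed

text \<open>
  Replace \<open>Z0\<close> by an aligned factor \<open>Z = X K + Z2\<close>. The error splits orthogonally as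
  \<open>E = (E + W) - W\<close> with \<open>W = Z2 Z2\<^sup>T\<close>: the part \<open>E + W\<close> is a tangent direction
  \<open>X V\<^sup>T + V X\<^sup>T\<close>, on which the first-order condition acts, and \<open>W\<close> is a sum of \<open>u u\<^sup>T\<close> with
  \<open>u\<close> orthogonal to the columns of \<open>X\<close>, on which the second-order condition acts. Testing with
  \<open>N = (E + W) - t W\<close> for a free \<open>t \<ge> 0\<close>, instead of only with \<open>E\<close> itself, is what reaches
  \<open>\<delta> < 1/2\<close>. The noise only enters through \<open>\<langle>w, L N\<rangle>\<close>, so it just turns \<open>\<delta> \<parallel>E\<parallel>\<close> into
  \<open>D = \<delta> \<parallel>E\<parallel> + \<epsilon>\<close>.
\<close>

lemma local_minimizer_error_bound:
  fixes L :: "real^'n^'n \<Rightarrow> real^'m" and X Z0 :: "real^'r^'n"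
  assumes lin: "linear L" and rip: "RIP L \<delta> (2 * CARD('r))" and \<delta>: "\<delta> < 1/2"
    and noise: "\<And>M. \<bar>w \<bullet> L M\<bar> \<le> \<epsilon> * norm M" and "0 \<le> \<epsilon>"
    and min: "local_minimizer (\<lambda>X. 1/2 * (norm (L (X ** transpose X) - L (Z0 ** transpose Z0) + w))\<^sup>2) X"
  shows "(1 - 2 * \<delta>) * norm (X ** transpose X - Z0 ** transpose Z0) \<le> 2 * \<epsilon>"
proof -
  obtain Z :: "real^'r^'n" where gram: "Z ** transpose Z = Z0 ** transpose Z0"
    and sym: "transpose (transpose X ** Z) = transpose X ** Z"
    by (rule aligned_factor)
  obtain K Z2 where Z: "Z = X ** K + Z2" and orth: "transpose X ** Z2 = 0"
    by (rule column_projection)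
  obtain v where v: "norm v = 1" "\<And>x. (norm (X *v v))\<^sup>2 * (norm x)\<^sup>2 \<le> (norm (X *v x))\<^sup>2"
    using smallest_singular_vector by blast
  define s where "s = (norm (X *v v))\<^sup>2"
  define E where "E = X ** transpose X - Z ** transpose Z"
  define W where "W = Z2 ** transpose Z2"
  define R where "R = L E + w"
  define e where "e = norm E"
  define c where "c = norm W"
  define q where "q = e\<^sup>2 - c\<^sup>2"
  define \<tau> where "\<tau> = s * (norm Z2)\<^sup>2"
  define D where "D = \<delta> * e + \<epsilon>"
  have \<delta>0: "0 \<le> \<delta>"
    using rip by (simp add: RIP_def)
  have R: "R = L (X ** transpose X) - L (Z0 ** transpose Z0) + w"
    by (simp add: R_def E_def gram linear_diff[OF lin])
  note conditions = factored_least_squares_conditions[OF lin min, folded R]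
  have orth': "transpose Z2 ** X = 0"
    using arg_cong[OF orth, of transpose]
    by (simp add: matrix_transpose_mul transpose_simps)
  have first_order: "R \<bullet> L (E + W) = 0"
  proof -
    \<comment> \<open>solves \<open>X V\<^sup>T + V X\<^sup>T = E + W\<close>, as \<open>E + W = X X\<^sup>T - X K K\<^sup>T X\<^sup>T - X K Z2\<^sup>T - Z2 K\<^sup>T X\<^sup>T\<close>\<close>
    define V where "V = (1/2) *\<^sub>R X - (1/2) *\<^sub>R (X ** K ** transpose K) - Z2 ** transpose K"
    have "X ** transpose V + V ** transpose X = E + W"
      unfolding V_def E_def W_def Z
      by (simp add: matmul_simps transpose_simps matrix_transpose_mul matrix_mul_assoc algebra_simps)
    then show ?thesis
      using conditions(1)[of V] by simp
  qed
  have second_order: "0 \<le> R \<bullet> L W + (1 + \<delta>) * \<tau>"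
  proof -
    \<comment> \<open>perturb by \<open>u v\<^sup>T\<close>, where \<open>v\<close> is the direction that \<open>X\<close> stretches least, to make the curvature term small\<close>
    have col: "0 \<le> R \<bullet> L (outer (column k Z2) (column k Z2)) + (1 + \<delta>) * (s * (norm (column k Z2))\<^sup>2)" for k
    proof -
      define u where "u = column k Z2"
      define p where "p = X *v v"
      have pu: "p \<bullet> u = 0"
      proof -
        have "u v* X = 0"
          using orth' by (simp add: u_def vec_eq_iff matrix_matrix_mult_def vector_matrix_mult_def transpose_def column_def)
        then show ?thesis
          by (metis p_def dot_lmul_matrix inner_commute inner_zero_left)
      qed
      have U: "X ** transpose (outer u v) + outer u v ** transpose X = outer p u + outer u p"
      proof -
        have "X ** transpose (outer u v) = outer p u"
          by (simp add: transpose_outer matrix_mult_outer p_def)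
        moreover from arg_cong[OF this, of transpose] have "outer u v ** transpose X = outer u p"
          by (simp add: transpose_outer matrix_transpose_mul)
        ultimately show ?thesis by simp
      qed
      have n: "(norm (outer p u + outer u p))\<^sup>2 = 2 * (s * (norm u)\<^sup>2)"
        unfolding power2_norm_eq_inner using pu
        by (simp add: inner_add inner_outer_outer inner_commute s_def p_def power2_norm_eq_inner)
      have "rank (outer p u + outer u p) \<le> 2 * CARD('r)"
        unfolding U[symmetric] by (rule rank_mult_sum_le)
      then have "(norm (L (outer p u + outer u p)))\<^sup>2 \<le> (1 + \<delta>) * (2 * (s * (norm u)\<^sup>2))"
        using rip unfolding RIP_def n[symmetric] by blast
      moreover have "outer u v ** transpose (outer u v) = outer u u"
        using v(1) by (simp add: transpose_outer outer_mult_outer norm_eq_1)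
      ultimately show ?thesis
        using conditions(2)[of "outer u v"] unfolding U by (simp add: u_def)
    qed
    have "0 \<le> (\<Sum>k\<in>UNIV. R \<bullet> L (outer (column k Z2) (column k Z2)) + (1 + \<delta>) * (s * (norm (column k Z2))\<^sup>2))"
      by (intro sum_nonneg col)
    also have "\<dots> = R \<bullet> L W + (1 + \<delta>) * \<tau>"
      by (simp add: W_def gram_eq_sum_outer linear_sum[OF lin] inner_sum_right sum.distrib
          \<tau>_def norm_square_eq_sum_columns sum_distrib_left)
    finally show ?thesis .
  qed
  have EW: "E \<bullet> W = - c\<^sup>2"
  proof -
    have "(X ** transpose X) \<bullet> W = 0"
      by (simp add: inner_matrix_mult_left W_def matrix_mul_assoc orth)
    moreover have "(Z ** transpose Z) \<bullet> W = W \<bullet> W"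
    proof -
      have "transpose Z2 ** Z = transpose Z2 ** Z2"
        by (simp add: Z matmul_simps matrix_mul_assoc orth')
      then have "W ** Z = W ** Z2"
        by (simp add: W_def flip: matrix_mul_assoc)
      moreover from arg_cong[OF this, of transpose] have "transpose Z ** W = transpose Z2 ** W"
        by (simp add: matrix_transpose_mul W_def)
      ultimately show ?thesis
        by (metis W_def inner_matrix_mult_left inner_matrix_mult_right transpose_transpose)
    qed
    ultimately show ?thesis
      by (simp add: E_def inner_diff c_def power2_norm_eq_inner)
  qed
  have q: "q = (norm (E + W))\<^sup>2"
    using EW unfolding q_def e_def c_def power2_norm_eq_inner by (simp add: inner_add inner_commute)
  have opt: "q + t * c\<^sup>2 - D * sqrt (q + t\<^sup>2 * c\<^sup>2) \<le> t * ((1 + \<delta>) * \<tau>)" if "0 \<le> t" for t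
  proof -
    define N where "N = E + (1 - t) *\<^sub>R W"
    have rank: "rank (a *\<^sub>R E + b *\<^sub>R N) \<le> 2 * CARD('r)" for a b
    proof -
      have "a *\<^sub>R E + b *\<^sub>R N = (a + b) *\<^sub>R E + (b * (1 - t)) *\<^sub>R W"
        by (simp add: N_def algebra_simps)
      also have "\<dots> = X ** ((a + b) *\<^sub>R transpose X - (b * (1 - t)) *\<^sub>R (K ** transpose Z2))
          + Z ** ((b * (1 - t)) *\<^sub>R transpose Z2 - (a + b) *\<^sub>R transpose Z)"
      proof -
        have "Z ** transpose Z2 = W + X ** K ** transpose Z2"
          by (simp add: W_def Z matmul_simps)
        then show ?thesis
          by (simp add: E_def matmul_simps matrix_mul_assoc algebra_simps)
      qed
      finally show ?thesis
        by (simp only: rank_mult_sum_le)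
    qed
    have EN: "E \<bullet> N = q + t * c\<^sup>2"
      using EW by (simp add: N_def inner_add q_def e_def power2_norm_eq_inner algebra_simps)
    have N2: "(norm N)\<^sup>2 = q + t\<^sup>2 * c\<^sup>2"
    proof -
      have "(norm N)\<^sup>2 = E \<bullet> E + 2 * ((1 - t) * (E \<bullet> W)) + (1 - t)\<^sup>2 * (W \<bullet> W)"
        unfolding power2_norm_eq_inner by (simp add: N_def inner_add inner_commute algebra_simps power2_eq_square)
      then show ?thesis
        unfolding EW q_def e_def c_def power2_norm_eq_inner by (simp add: algebra_simps power2_eq_square)
    qed
    then have N: "norm N = sqrt (q + t\<^sup>2 * c\<^sup>2)"
      by (metis norm_ge_zero real_sqrt_unique)
    have "N = (E + W) - t *\<^sub>R W"
      by (simp add: N_def algebra_simps)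
    then have "R \<bullet> L N = - t * (R \<bullet> L W)"
      using first_order by (simp add: linear_diff[OF lin] linear_scale[OF lin] inner_diff)
    moreover have "0 \<le> t * (R \<bullet> L W + (1 + \<delta>) * \<tau>)"
      using second_order that by simp
    ultimately have "R \<bullet> L N \<le> t * ((1 + \<delta>) * \<tau>)"
      by (simp add: algebra_simps)
    moreover have "R \<bullet> L N = L E \<bullet> L N + w \<bullet> L N"
      by (simp add: R_def inner_add)
    moreover have "E \<bullet> N - \<delta> * norm E * norm N \<le> L E \<bullet> L N"
      by (rule RIP_inner[OF rip lin rank])
    moreover have "- (\<epsilon> * norm N) \<le> w \<bullet> L N"
      using noise[of N] by linarith
    ultimately show ?thesis
      unfolding N[symmetric] by (simp add: EN D_def e_def algebra_simps)
  qed
  have \<tau>0: "0 \<le> \<tau>"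
    by (simp add: \<tau>_def s_def)
  have "(1 - 2 * \<delta>) * e \<le> 2 * \<epsilon>"
  proof (rule ccontr)
    assume neg: "\<not> ?thesis"
    have e0: "0 < e"
      using neg \<delta> \<open>0 \<le> \<epsilon>\<close> by (cases "e = 0") (auto simp: e_def)
    have opt': "q + t * c\<^sup>2 - D * sqrt (q + t\<^sup>2 * c\<^sup>2) \<le> t * (3/2 * \<tau>)" if "0 \<le> t" for t
    proof -
      have "t * ((1 + \<delta>) * \<tau>) \<le> t * (3/2 * \<tau>)"
        using that \<tau>0 \<delta> by (intro mult_left_mono mult_right_mono) auto
      with opt[OF that] show ?thesis by linarith
    qed
    have key: "2 * \<kappa> * \<tau> - \<kappa>\<^sup>2 * c\<^sup>2 \<le> q" if "0 \<le> \<kappa>" "\<kappa> \<le> 1" for \<kappa>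
      using residual_energy_bound[OF Z orth sym v(2) that]
      by (simp add: q_def e_def c_def E_def W_def \<tau>_def s_def)
    show False
    proof (rule scalar_contradiction[OF e0 _ _ _ \<tau>0 _ _ key opt'])
      show "e\<^sup>2 = q + c\<^sup>2" by (simp add: q_def)
      show "0 \<le> c" by (simp add: c_def)
      show "0 \<le> q" by (simp add: q)
      show "0 \<le> D" using \<delta>0 e0 \<open>0 \<le> \<epsilon>\<close> by (simp add: D_def)
      show "D < e / 2" using neg by (simp add: D_def algebra_simps)
    qed
  qed
  then show ?thesis
    by (simp add: e_def E_def gram)
qed

section \<open>Measurability\<close>

text \<open>
  A projection of a Borel set need not be Borel, so measurability of the exceptional event needs an
  argument. Being a local minimiser with a prescribed radius \<open>1 / Suc k\<close> is a closed condition on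
  the pair of parameter and point, and an open \<open>U\<close> is a countable union of compact sets. The pairs
  are therefore \<open>\<sigma>\<close>-compact, a property that projections preserve.
\<close>

lemma borel_exists_local_minimizer:
  fixes f :: "'a::euclidean_space \<Rightarrow> 'b::euclidean_space \<Rightarrow> real"
  assumes cont: "continuous_on UNIV (\<lambda>(w, x). f w x)" and U: "open U"
  shows "{w. \<exists>x\<in>U. local_minimizer (f w) x} \<in> sets borel"
proof -
  obtain C where C: "\<And>n. compact (C n)" "U = (\<Union>n::nat. C n)"
    using open_Union_compact_subsets[OF U] by metis
  define S where "S k = {p. \<forall>z. norm z < 1 / real (Suc k) \<longrightarrow> f (fst p) (snd p) \<le> f (fst p) (snd p + z)}" for k
  have cont': "continuous_on UNIV (\<lambda>p. f (g p) (h p))"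
    if "continuous_on UNIV g" "continuous_on UNIV h" for g :: "'a \<times> 'b \<Rightarrow> 'a" and h :: "'a \<times> 'b \<Rightarrow> 'b"
    using continuous_on_compose2[OF cont continuous_on_Pair[OF that]] by simp
  have closed_S: "closed (S k)" for k
    unfolding S_def
    by (intro closed_Collect_all closed_Collect_imp closed_Collect_le cont' continuous_intros open_Collect_const)
  have local_min_iff: "local_minimizer (f w) x \<longleftrightarrow> (\<exists>k. (w, x) \<in> S k)" for w x
  proof
    assume "local_minimizer (f w) x"
    then obtain d where d: "0 < d" "\<And>y. dist y x < d \<Longrightarrow> f w x \<le> f w y"
      unfolding local_minimizer_def eventually_nhds_metric by blast
    obtain k where "1 / real (Suc k) < d"
      using d(1) by (metis nat_approx_posE)
    then have "(w, x) \<in> S k"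
      unfolding S_def by (auto intro!: d(2) simp: dist_norm)
    then show "\<exists>k. (w, x) \<in> S k" ..
  next
    assume "\<exists>k. (w, x) \<in> S k"
    then obtain k where k: "\<And>z. norm z < 1 / real (Suc k) \<Longrightarrow> f w x \<le> f w (x + z)"
      by (auto simp: S_def)
    have "f w x \<le> f w y" if "dist y x < 1 / real (Suc k)" for y
      using k[of "y - x"] that by (simp add: dist_norm)
    then show "local_minimizer (f w) x"
      unfolding local_minimizer_def eventually_nhds_metric
      by (intro exI[of _ "1 / real (Suc k)"]) auto
  qed
  have "{w. \<exists>x\<in>U. local_minimizer (f w) x}
      = (\<Union>k n j. fst ` (S k \<inter> (cball 0 (real j) \<times> C n)))" (is "?L = ?R")
  proof (rule set_eqI)
    fix w :: 'a
    obtain j :: nat where j: "w \<in> cball 0 (real j)"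
      using real_arch_simple[of "norm w"] by auto
    show "w \<in> ?L \<longleftrightarrow> w \<in> ?R"
    proof
      assume "w \<in> ?L"
      then obtain k n x where "(w, x) \<in> S k" "x \<in> C n"
        unfolding C(2) local_min_iff by blast
      with j have "(w, x) \<in> S k \<inter> (cball 0 (real j) \<times> C n)"
        by blast
      then have "w \<in> fst ` (S k \<inter> (cball 0 (real j) \<times> C n))"
        by (rule image_eqI[rotated]) simp
      then show "w \<in> ?R"
        by blast
    next
      assume "w \<in> ?R"
      then show "w \<in> ?L"
        unfolding C(2) local_min_iff by auto blast
    qed
  qed
  moreover have "fst ` (S k \<inter> (cball 0 (real j) \<times> C n)) \<in> sets borel" for k n j
  proof -
    have "compact (S k \<inter> (cball 0 (real j) \<times> C n))"
      by (intro closed_Int_compact closed_S compact_Times C compact_cball)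
    then have "compact (fst ` (S k \<inter> (cball 0 (real j) \<times> C n)))"
      by (intro compact_continuous_image continuous_intros)
    then show ?thesis
      by (intro borel_closed compact_imp_closed)
  qed
  ultimately show ?thesis
    by (simp only:) (intro sets.countable_UN'' countableI_type)
qed

section \<open>Recovery guarantee\<close>

theorem theorem2:
  fixes Mstar :: "real^'n^'n"
    and A :: "'m::finite \<Rightarrow> real^'n^'n"
    and b :: "real^'m"
    and P :: "'w measure"
    and w :: "'w \<Rightarrow> real^'m"
    and \<delta> \<epsilon> :: real
  assumes "sym_psd Mstar"
    and "rank Mstar = CARD('r::finite)"
    and "b = sensing_op A Mstar"
    and "prob_space P"
    and "w \<in> borel_measurable P"
    and "RIP (sensing_op A) \<delta> (2 * CARD('r))"
    and "\<delta> < 1/2"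
    and "\<epsilon> > 0"
  shows "measure P {\<omega> \<in> space P. \<forall>X :: real^'r^'n. local_minimizer (objective A b (w \<omega>)) X \<longrightarrow>
            (1 - \<delta>) * (norm (X ** transpose X - Mstar))\<^sup>2
              \<le> \<epsilon> * sqrt (real CARD('r)) * norm (X ** transpose X - Mstar)
                + 4 * \<epsilon> * sqrt (real CARD('r)) * norm Mstar
          \<or> 2 * (1 - 2 * \<delta>) / (3 * (1 + \<delta>)) * norm (X ** transpose X - Mstar)
              \<le> 2 * \<epsilon> * sqrt (real CARD('r))
                + 2 * sqrt (2 * \<epsilon> * (1 + \<delta>))
                    * (sqrt (norm (X ** transpose X - Mstar)) + sqrt (norm Mstar))}
         \<ge> measure P {\<omega> \<in> space P. norm (transpose (sensing_matrix A) *v w \<omega>) \<le> \<epsilon>}"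
    (is "measure P {\<omega> \<in> space P. \<forall>X. _ \<longrightarrow> ?quadratic X \<or> ?linear X} \<ge> _")
proof -
  interpret prob_space P by fact
  have \<delta>0: "0 \<le> \<delta>"
    using assms(6) by (simp add: RIP_def)
  let ?bad = "{X :: real^'r^'n. \<not> (?quadratic X \<or> ?linear X)}"
  have "open ?bad"
    unfolding de_Morgan_disj not_le
    by (intro open_Collect_conj open_Collect_less continuous_intros continuous_gram)
  moreover have "continuous_on UNIV (\<lambda>(v, X :: real^'r^'n). objective A b v X)"
  proof -
    have "continuous_on UNIV (\<lambda>p :: (real^'m) \<times> (real^'r^'n). snd p ** transpose (snd p))"
      by (rule continuous_on_compose2[OF continuous_gram[of UNIV]]) (auto intro: continuous_intros)
    moreover have "bounded_linear (sensing_op A)"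
      using linear_sensing_op linear_conv_bounded_linear by blast
    ultimately have "continuous_on UNIV (\<lambda>p :: (real^'m) \<times> (real^'r^'n). sensing_op A (snd p ** transpose (snd p)))"
      using continuous_on_compose2[OF linear_continuous_on[of "sensing_op A" UNIV]] by blast
    then show ?thesis
      unfolding objective_def case_prod_unfold by (intro continuous_intros)
  qed
  ultimately have "{v. \<exists>X\<in>?bad. local_minimizer (objective A b v) X} \<in> sets borel"
    by (intro borel_exists_local_minimizer)
  then have "w -` (- {v. \<exists>X\<in>?bad. local_minimizer (objective A b v) X}) \<inter> space P \<in> sets P"
    by (intro measurable_sets[OF assms(5)]) auto
  also have "w -` (- {v. \<exists>X\<in>?bad. local_minimizer (objective A b v) X}) \<inter> space P
      = {\<omega> \<in> space P. \<forall>X :: real^'r^'n. local_minimizer (objective A b (w \<omega>)) X \<longrightarrow> ?quadratic X \<or> ?linear X}"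
    by blast
  finally have measurable_good: "\<dots> \<in> sets P" .
  obtain Z :: "real^'r^'n" where Z: "Mstar = Z ** transpose Z"
    using sym_psd_factor[OF assms(1), where 'r = 'r] assms(2) by auto
  have "?linear X" if small: "norm (transpose (sensing_matrix A) *v v) \<le> \<epsilon>"
    and min: "local_minimizer (objective A b v) X" for v and X :: "real^'r^'n"
  proof -
    let ?e = "norm (X ** transpose X - Mstar)"
    have noise: "\<bar>v \<bullet> sensing_op A M\<bar> \<le> \<epsilon> * norm M" for M
      using sensing_op_noise_bound[of v A M] mult_right_mono[OF small norm_ge_zero[of M]] by linarith
    have "local_minimizer (\<lambda>X. 1/2 * (norm (sensing_op A (X ** transpose X)
        - sensing_op A (Z ** transpose Z) + v))\<^sup>2) X"
      using min unfolding objective_def assms(3) Z .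
    then have bound: "(1 - 2 * \<delta>) * ?e \<le> 2 * \<epsilon>"
      using local_minimizer_error_bound[OF linear_sensing_op assms(6,7) noise] assms(8) by (simp add: Z)
    have "2 * (1 - 2 * \<delta>) / (3 * (1 + \<delta>)) * ?e = 2 / (3 * (1 + \<delta>)) * ((1 - 2 * \<delta>) * ?e)"
      by simp
    also have "\<dots> \<le> 1 * (2 * \<epsilon>)"
      using \<delta>0 assms(7,8) by (intro mult_mono bound) auto
    also have "\<dots> \<le> 2 * \<epsilon> * sqrt (real CARD('r))"
      using assms(8) by (simp add: Suc_le_eq)
    also have "\<dots> \<le> \<dots> + 2 * sqrt (2 * \<epsilon> * (1 + \<delta>)) * (sqrt ?e + sqrt (norm Mstar))"
      using \<delta>0 assms(8) by simp
    finally show ?thesis .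
  qed
  then show ?thesis
    by (intro finite_measure_mono measurable_good) blast
qed

end
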